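(* Suppose $P\in(\underline{\alpha},\overline{\alpha})$ or $P\in(\underline{\beta},\overline{\beta})$, and $\varepsilon=0$. Let $\tau=\sigma'(P)$, $\bar u_k=kh_1P$ and $a_k=\frac{\pi k}{n}$. Then the curves $$u^c_k(t)=\bar u_k+\exp(\lambda^ct)\sum_{j=1}^n\eta_j\exp(ia_kj),\qquad k=1,\dots,n,\ t\in\mathbb{R},$$ where $\lambda^c=\pm2in\sqrt{\tau}\,\sin\frac{k\pi}{2n}$, are periodic with period $$T_k=\frac{\pi}{n\sqrt{\tau}}\,\operatorname{cosec}\frac{k\pi}{2n},\qquad k=1,\dots,n.$$
   Context: $P>0$, $n\ge2$ is an integer, $h_1=1/n$, $\operatorname{cosec}x=1/\sin x$, and $\eta_j\in(-a,a)$ are real parameters (with some $a>0$). The function $\sigma:\mathbb{R}\to\mathbb{R}$ is continuously differentiable, $\sigma(0)=0$, $\sigma(\xi)>0$ for $\xi>0$, $\sigma(\xi)<0$ for $\xi<0$. There are numbers $0<\underline{\alpha}<\overline{\alpha}<\underline{\beta}<\overline{\beta}$ such that $\sigma'(\xi)>0$ for $\xi\in(-\infty,\overline{\alpha})\cup(\underline{\beta},\infty)$, $\sigma'(\xi)<0$ for $\xi\in(\overline{\alpha},\underline{\beta})$, $\sigma(\underline{\alpha})=\sigma(\underline{\beta})$ and $\sigma(\overline{\alpha})=\sigma(\overline{\beta})$. Here $\bar u$ is the uniphase steady solution of the system $$\ddot u_k-\frac1{h_1}\sigma(\Delta u_{k+1})+\frac1{h_1}\sigma(\Delta u_k)=\frac{\varepsilon}{h_1^2}(\dot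 u_{k+1}-2\dot u_k+\dot u_{k-1}),\quad k=1,\dots,n-1,$$ with $u_0=0$, $u_n=P$, $\Delta u_k=\frac1{h_1}(u_k-u_{k-1})$. *)

theory Defs
  imports "HOL-Analysis.Analysis" "HOL-Library.Periodic_Fun"
begin

definition cosec :: "real \<Rightarrow> real" where
  "cosec x = 1 / sin x"

text \<open>
  The stress-strain law. The arguments \<open>al < au < bl < bu\<close> are the numbers written
  underlined alpha, overlined alpha, underlined beta, overlined beta.
\<close>

definition stress_law :: "(real \<Rightarrow> real) \<Rightarrow> real \<Rightarrow> real \<Rightarrow> real \<Rightarrow> real \<Rightarrow> bool" where
  "stress_law \<sigma> al au bl bu \<longleftrightarrow>
     \<sigma> C1_differentiable_on UNIV \<and>
     \<sigma> 0 = 0 \<and> (\<forall>\<xi>>0. \<sigma> \<xi> > 0) \<and> (\<forall>\<xi><0. \<sigma> \<xi> < 0) \<and>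
     0 < al \<and> al < au \<and> au < bl \<and> bl < bu \<and>
     (\<forall>\<xi> \<in> {..<au} \<union> {bl<..}. deriv \<sigma> \<xi> > 0) \<and>
     (\<forall>\<xi> \<in> {au<..<bl}. deriv \<sigma> \<xi> < 0) \<and>
     \<sigma> al = \<sigma> bl \<and> \<sigma> au = \<sigma> bu"

text \<open>The backward difference quotient \<open>\<Delta> y\<^sub>k\<close>; only used for \<open>k \<ge> 1\<close>.\<close>

definition strain :: "real \<Rightarrow> (nat \<Rightarrow> real) \<Rightarrow> nat \<Rightarrow> real" where
  "strain h y k = (y k - y (k - 1)) / h"

text \<open>
  The masses \<open>u\<^sub>0, \<dots>, u\<^sub>n\<close> have velocities \<open>v\<close>, the interior ones also accelerations \<open>w\<close>.
\<close>

definition solves_system ::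
  "nat \<Rightarrow> real \<Rightarrow> (real \<Rightarrow> real) \<Rightarrow> real \<Rightarrow> real \<Rightarrow> (nat \<Rightarrow> real \<Rightarrow> real) \<Rightarrow> bool" where
  "solves_system n h \<sigma> \<epsilon> P u \<longleftrightarrow>
     (\<exists>v w.
       (\<forall>k\<le>n. \<forall>t. (u k has_real_derivative v k t) (at t)) \<and>
       (\<forall>k\<in>{1..n - 1}. \<forall>t. (v k has_real_derivative w k t) (at t)) \<and>
       (\<forall>k\<in>{1..n - 1}. \<forall>t.
          w k t - 1 / h * \<sigma> (strain h (\<lambda>j. u j t) (k + 1)) + 1 / h * \<sigma> (strain h (\<lambda>j. u j t) k)
          = \<epsilon> / h\<^sup>2 * (v (k + 1) t - 2 * v k t + v (k - 1) t))) \<and>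
     (\<forall>t. u 0 t = 0 \<and> u n t = P)"

definition steady_solution ::
  "nat \<Rightarrow> real \<Rightarrow> (real \<Rightarrow> real) \<Rightarrow> real \<Rightarrow> real \<Rightarrow> (nat \<Rightarrow> real) \<Rightarrow> bool" where
  "steady_solution n h \<sigma> \<epsilon> P y \<longleftrightarrow> solves_system n h \<sigma> \<epsilon> P (\<lambda>k t. y k)"

text \<open>
  The phases are the three intervals of strict monotonicity of the stress-strain law; in a
  uniphase configuration all strains lie in the same phase.
\<close>

definition uniphase :: "nat \<Rightarrow> real \<Rightarrow> real \<Rightarrow> real \<Rightarrow> (nat \<Rightarrow> real) \<Rightarrow> bool" where
  "uniphase n h au bl y \<longleftrightarrow>
     (\<exists>I \<in> {{..<au}, {au<..<bl}, {bl<..}}. \<forall>k\<in>{1..n}. strain h y k \<in> I)"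

text \<open>
  The linear profile is a uniphase steady solution, so hypotheses asking for both are
  satisfiable whenever \<open>P\<close> lies in a phase.
\<close>

lemma strain_linear:
  assumes "n \<ge> 2" "k \<in> {1..n}" "\<forall>k\<le>n. y k = real k * (1 / real n) * P"
  shows "strain (1 / real n) y k = P"
proof -
  have "y k = real k * (1 / real n) * P" "y (k - 1) = (real k - 1) * (1 / real n) * P"
    using assms by (auto simp: of_nat_diff)
  then show ?thesis using assms(1) by (simp add: strain_def field_simps)
qed

lemma linear_uniphase_steady:
  assumes n: "n \<ge> 2" and P: "P < au \<or> (au < P \<and> P < bl) \<or> bl < P"
    and y: "\<forall>k\<le>n. y k = real k * (1 / real n) * P"
  shows "steady_solution n (1 / real n) \<sigma> \<epsilon> P y" "uniphase n (1 / real n) au bl y"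
proof -
  have s: "strain (1 / real n) y k = P" if "k \<in> {1..n}" for k
    using strain_linear[OF n that y] .
  show "steady_solution n (1 / real n) \<sigma> \<epsilon> P y"
    unfolding steady_solution_def solves_system_def
    using n y s
    by (intro conjI exI[of _ "\<lambda>k t. 0"]) auto
  show "uniphase n (1 / real n) au bl y"
    unfolding uniphase_def using P s by auto
qed

text \<open>The complex curve \<open>u\<^sup>c\<^sub>k\<close> with temporal exponent \<open>lam\<close>.\<close>

definition curve ::
  "nat \<Rightarrow> (nat \<Rightarrow> real) \<Rightarrow> (nat \<Rightarrow> real) \<Rightarrow> nat \<Rightarrow> complex \<Rightarrow> real \<Rightarrow> complex" where
  "curve n y \<eta> k lam t =
     of_real (y k) +
     exp (lam * of_real t) *
     (\<Sum>j = 1..n. of_real (\<eta> j) * exp (\<i> * of_real (pi * real k / real n) * of_nat j))"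

text \<open>Periods are positive, but need not be minimal: the curves may be constant.\<close>

definition periodic_with_period :: "(real \<Rightarrow> complex) \<Rightarrow> real \<Rightarrow> bool" where
  "periodic_with_period f T \<longleftrightarrow> T > 0 \<and> periodic_fun_simple f T"

end

theory Submission
  imports Defs
begin

text \<open>
  Each curve depends on time only through the factor \<open>exp (lam * t)\<close>, so it repeats
  as soon as \<open>lam * T\<close> is \<open>2 * \<pi> * \<i>\<close> up to sign.
  For \<open>lam = \<plusminus>2 * \<i> * n * sqrt \<tau> * sin (k * \<pi> / (2 * n))\<close> the number \<open>T\<close> of the theorem is exactly
  \<open>2 * \<pi> / \<bar>lam\<bar>\<close>. This makes sense because \<open>lam\<close> is a nonzero imaginary number: \<open>P\<close> lies on an
  increasing branch of the stress-strain law, so \<open>\<tau> > 0\<close>, and \<open>k * \<pi> / (2 * n)\<close> lies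
  in \<open>{0<..pi / 2}\<close>, where the sine is positive.
\<close>

lemma stress_law_deriv_pos:
  assumes "stress_law \<sigma> al au bl bu" "P \<in> {al<..<au} \<or> P \<in> {bl<..<bu}"
  shows "deriv \<sigma> P > 0"
  using assms unfolding stress_law_def by auto

lemma curve_periodic:
  assumes "T > 0" "exp (lam * of_real T) = 1"
  shows "periodic_with_period (curve n y \<eta> k lam) T"
  unfolding periodic_with_period_def
proof
  show "periodic_fun_simple (curve n y \<eta> k lam) T"
    by unfold_locales (simp add: curve_def distrib_left exp_add assms(2))
qed (fact assms(1))

lemma sin_half_wave_number_pos:
  assumes "k \<in> {1..n}"
  shows "sin (real k * pi / (2 * real n)) > 0"
proof (rule sin_gt_zero)
  show "real k * pi / (2 * real n) > 0" using assms by simp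
  have "real k * pi < pi * (2 * real n)" using assms by simp
  then show "real k * pi / (2 * real n) < pi" using assms by (simp add: field_simps)
qed

theorem theorem3p4:
  fixes n :: nat and P \<epsilon> a h1 \<tau> al au bl bu :: real
    and \<sigma> :: "real \<Rightarrow> real" and \<eta> ubar :: "nat \<Rightarrow> real"
  assumes "P > 0" and "n \<ge> 2" and "h1 = 1 / real n"
    and "a > 0" and "\<forall>j\<in>{1..n}. \<eta> j \<in> {-a<..<a}"
    and "stress_law \<sigma> al au bl bu"
    and "P \<in> {al<..<au} \<or> P \<in> {bl<..<bu}"
    and "\<epsilon> = 0"
    and "\<tau> = deriv \<sigma> P"
    and "\<forall>k\<le>n. ubar k = real k * h1 * P"
    and "steady_solution n h1 \<sigma> \<epsilon> P ubar" and "uniphase n h1 au bl ubar"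
  shows "\<forall>k\<in>{1..n}.
    \<forall>lam \<in> {2 * \<i> * of_nat n * of_real (sqrt \<tau>) * of_real (sin (real k * pi / (2 * real n))),
            - (2 * \<i> * of_nat n * of_real (sqrt \<tau>) * of_real (sin (real k * pi / (2 * real n))))}.
      periodic_with_period (curve n ubar \<eta> k lam)
        (pi / (real n * sqrt \<tau>) * cosec (real k * pi / (2 * real n)))"
proof (intro ballI)
  fix k lam
  assume k: "k \<in> {1..n}"
  define s where "s = sin (real k * pi / (2 * real n))"
  define T where "T = pi / (real n * sqrt \<tau>) * cosec (real k * pi / (2 * real n))"
  assume "lam \<in> {2 * \<i> * of_nat n * of_real (sqrt \<tau>) * of_real (sin (real k * pi / (2 * real n))),
            - (2 * \<i> * of_nat n * of_real (sqrt \<tau>) * of_real (sin (real k * pi / (2 * real n))))}"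
  then have lam: "lam = \<i> * of_real (2 * real n * sqrt \<tau> * s) \<or>
                  lam = - (\<i> * of_real (2 * real n * sqrt \<tau> * s))"
    by (auto simp: s_def)
  have "s > 0" unfolding s_def by (rule sin_half_wave_number_pos[OF k])
  moreover have "\<tau> > 0"
    using stress_law_deriv_pos[OF assms(6,7)] assms(9) by simp
  moreover have "T = pi / (real n * sqrt \<tau> * s)"
    by (simp add: T_def s_def cosec_def)
  ultimately have "T > 0" and turn: "2 * real n * sqrt \<tau> * s * T = 2 * pi"
    using assms(2) by simp_all
  have "lam * of_real T = 2 * of_real pi * \<i> \<or> lam * of_real T = - (2 * of_real pi * \<i>)"
    using lam turn[THEN arg_cong, of complex_of_real] by (auto simp: mult_ac)
  then have "exp (lam * of_real T) = 1"
    by (auto simp: exp_minus)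
  with \<open>T > 0\<close> show "periodic_with_period (curve n ubar \<eta> k lam)
        (pi / (real n * sqrt \<tau>) * cosec (real k * pi / (2 * real n)))"
    unfolding T_def by (rule curve_periodic)
qed

end
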